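(* Let $T$ be an i.i.d. random system on $(M,\mathfrak{B})$ over $(\Omega,\mathfrak{F},P,\{\theta_t\})$ with ergodic stationary probability measure $\mu$ and stochastic Koopman operator $\mathcal{K}$. Let $l\ge k\ge 1$, let $\tilde{\mathbf f}=(\tilde f_1,\dots,\tilde f_k)^T:M\times\Omega\to\mathbb{C}^k$ and $\tilde{\mathbf g}=(\tilde g_1,\dots,\tilde g_l)^T:M\times\Omega\to\mathbb{C}^l$ be vectors of noisy observables, with means $\mathbf f(x)=\int_\Omega\tilde{\mathbf f}_\omega(x)\,dP(\omega)$ and $\mathbf g(x)=\int_\Omega\tilde{\mathbf g}_\omega(x)\,dP(\omega)$, which are assumed to exist and to have components $f_1,\dots,f_k$ and $g_1,\dots,g_l$ in $L^2(\mu)$. Assume: (1) for every integer $j\ge 0$, the entries of $(x,\omega)\mapsto\tilde{\mathbf f}_{\theta_j\omega}(T_\omega^jx)\,\tilde{\mathbf g}_\omega(x)^*$ are $\mu\times P$-integrable and, for $\mu\times P$-almost every $(x_0,\omega_0)$, $$\lim_{n\to\infty}\frac1n\sum_{m=0}^{n-1}\hat{\mathbf f}(m+j)\,\hat{\mathbf g}(m)^*=\int_M\int_\Omega\tilde{\mathbf f}_{\theta_j\omega}(T_\omega^jx)\,\tilde{\mathbf g}_\omega(x)^*\,dP(\omega)\,d\mu(x);$$ (2) for every integer $j\ge 0$ and $\mu$-almost every $x$, $\int_\Omega\tilde{\mathbf f}_{\theta_j\omega}(T^j_\omega x)\,dP(\omega)=\mathcal{K}^j\mathbf f(x)$ (componentwise);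 (3) the random function $\tilde{\mathbf g}_\omega$ is independent of $\big(\tilde{\mathbf f}_\omega,\tilde{\mathbf f}_{\theta\omega},T_\omega\big)$; (4) $f_1,\dots,f_k$ span a $k$-dimensional subspace $\mathscr{F}\subset L^2(\mu)$ which is invariant under $\mathcal{K}$, and $\mathscr{F}\subset\operatorname{span}\{g_1,\dots,g_l\}$. Let $\mathbf K\in\mathbb{C}^{k\times k}$ be the matrix of $\mathcal{K}|_{\mathscr{F}}$, defined by $\mathbf K\,[f_1,\dots,f_k]^T=[\mathcal{K}f_1,\dots,\mathcal{K}f_k]^T$. For $n\ge1$ put $$\tilde G_{0,n}=\frac1n\sum_{m=0}^{n-1}\hat{\mathbf f}(m)\hat{\mathbf g}(m)^*,\qquad \tilde G_{1,n}=\frac1n\sum_{m=0}^{n-1}\hat{\mathbf f}(m+1)\hat{\mathbf g}(m)^*,\qquad C_n=\tilde G_{1,n}\,\tilde G_{0,n}^{\dagger}.$$ Then for $\mu\times P$-almost every $(x_0,\omega_0)$, $C_n\to\mathbf K$ as $n\to\infty$.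
   Context: Setting. $(\Omega,\mathfrak{F},P)$ is a probability space, $\mathbb{T}=\mathbb{Z}$ or $\mathbb{Z}^+$ (nonnegative integers), and $\{\theta_t\}_{t\in\mathbb{T}}$ is a (semi)group of measurable $P$-preserving maps of $\Omega$; $\theta:=\theta_1$. $(M,\mathfrak{B})$ is a measurable space. An i.i.d. random system $T$ assigns to each $\omega\in\Omega$ a $\mathfrak{B}$-measurable map $T_\omega:M\to M$ such that the random maps $T_{\theta_t\omega}$, $t\in\mathbb{T}$, are independent and identically distributed. Put $T^0_\omega=\mathrm{id}$ and $T^n_\omega=T_{\theta_{n-1}\omega}\circ\cdots\circ T_{\theta\omega}\circ T_\omega$. For initial data $(x_0,\omega_0)$ write $x_t=T^t_{\omega_0}x_0$, $\omega_t=\theta_t\omega_0$. The stochastic Koopman operators are $\mathcal{K}^tf(x)=\int_\Omega f(T^t_\omega x)\,dP(\omega)$, with $\mathcal{K}=\mathcal{K}^1$. A probability measure $\mu$ on $M$ is stationary if $\mu(A)=\int_M\int_\Omega\chi_A(T_\omega x)\,dP\,d\mu$ for all $A\in\mathfrak{B}$. A set $A\in\mathfrak{B}$ is invariant if $\int_\Omega\chi_A(T_\omega x)\,dP=\chi_A(x)$ for $\mu$-a.e. $x$; $\mu$ is ergodic if every invariant set has measure $0$ or $1$. A noisy observable is a measurable map $\tilde f:M\times\Omega\to\mathbb{C}$ such that $\tilde f_\omega=\tilde f(\cdot,\omega)$ is $\mathfrak{B}$-measurable for almost every $\omega$. Its time samples are $\hat f(t)=\tilde f(x_t,\omega_t)$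 (componentwise for vectors). Convention on independence of random functions/maps: each random function or map $h_\omega$ on $M$ comes with a sub-$\sigma$-algebra $\sigma(h)\subset\mathfrak{F}$ such that $(x,\omega)\mapsto h_\omega(x)$ is $\mathfrak{B}\otimes\sigma(h)$-measurable; the shifted function $h_{\theta_t\omega}$ has $\sigma$-algebra $\theta_t^{-1}\sigma(h)$; independence means independence of these $\sigma$-algebras (for a tuple or family, of the $\sigma$-algebra they generate). $^*$ denotes conjugate transpose, $^\dagger$ the Moore–Penrose pseudoinverse. The matrix $C_n$ is the output of "Noise Resistant DMD": with data matrices $X=[\hat{\mathbf f}(0)\cdots\hat{\mathbf f}(n-1)]$, $Y=[\hat{\mathbf f}(1)\cdots\hat{\mathbf f}(n)]$, $Z=[\hat{\mathbf g}(0)\cdots\hat{\mathbf g}(n-1)]$, one has $C_n=(\tfrac1nYZ^* )(\tfrac1nXZ^* )^\dagger$. *)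

theory Defs
  imports "HOL-Probability.Probability"
begin

section \<open>Random systems\<close>

text \<open>
  The measurable space \<open>(M, \<BB>)\<close> is a value of type \<^typ>\<open>'x measure\<close> of which only the carrier and the
  \<open>\<sigma>\<close>-algebra are used. Sub-\<open>\<sigma>\<close>-algebras of the probability space \<open>P\<close> are represented in the
  same way, through \<^const>\<open>subalgebra\<close>. Time is the set \<open>\<T>\<close> of integers, which is either all of
  \<open>\<int>\<close> or the nonnegative integers; values \<open>\<theta> t\<close> with \<open>t \<notin> \<T>\<close> are irrelevant.
\<close>

definition measure_preserving_action :: "int set \<Rightarrow> 'w measure \<Rightarrow> (int \<Rightarrow> 'w \<Rightarrow> 'w) \<Rightarrow> bool" where
  "measure_preserving_action \<T> P \<theta> \<longleftrightarrow>
     (\<T> = UNIV \<or> \<T> = {0..}) \<and>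
     (\<forall>t\<in>\<T>. \<theta> t \<in> P \<rightarrow>\<^sub>M P \<and> distr P P (\<theta> t) = P) \<and>
     (\<forall>\<omega>\<in>space P. \<theta> 0 \<omega> = \<omega>) \<and>
     (\<forall>s\<in>\<T>. \<forall>t\<in>\<T>. \<forall>\<omega>\<in>space P. \<theta> (s + t) \<omega> = \<theta> s (\<theta> t \<omega>))"

text \<open>A random function \<open>h\<close> together with its \<open>\<sigma>\<close>-algebra \<open>S = \<sigma>(h)\<close>.\<close>

definition random_function ::
  "'x measure \<Rightarrow> 'w measure \<Rightarrow> 'y measure \<Rightarrow> 'w measure \<Rightarrow> ('w \<Rightarrow> 'x \<Rightarrow> 'y) \<Rightarrow> bool" where
  "random_function M P N S h \<longleftrightarrow>
     subalgebra P S \<and> (\<lambda>(x, \<omega>). h \<omega> x) \<in> M \<Otimes>\<^sub>M S \<rightarrow>\<^sub>M N"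

definition shift_algebra ::
  "'w measure \<Rightarrow> (int \<Rightarrow> 'w \<Rightarrow> 'w) \<Rightarrow> int \<Rightarrow> 'w measure \<Rightarrow> 'w measure" where
  "shift_algebra P \<theta> t S = vimage_algebra (space P) (\<theta> t) S"

definition joint_algebra :: "'w measure \<Rightarrow> 'w measure set \<Rightarrow> 'w measure" where
  "joint_algebra P \<S> = sigma (space P) (\<Union>S\<in>\<S>. sets S)"

text \<open>
  The law of a random map is taken on the product \<open>\<sigma>\<close>-algebra of \<open>M ^ M\<close>, i.e. it is given by
  the finite-dimensional distributions.
\<close>

definition random_map_law ::
  "'x measure \<Rightarrow> 'w measure \<Rightarrow> ('w \<Rightarrow> 'x \<Rightarrow> 'x) \<Rightarrow> ('x \<Rightarrow> 'x) measure" where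
  "random_map_law M P h =
     distr P (\<Pi>\<^sub>M x\<in>space M. M) (\<lambda>\<omega>. restrict (h \<omega>) (space M))"

definition iid_random_system ::
  "'x measure \<Rightarrow> 'w measure \<Rightarrow> int set \<Rightarrow> (int \<Rightarrow> 'w \<Rightarrow> 'w) \<Rightarrow> 'w measure \<Rightarrow>
   ('w \<Rightarrow> 'x \<Rightarrow> 'x) \<Rightarrow> bool" where
  "iid_random_system M P \<T> \<theta> S T \<longleftrightarrow>
     (\<forall>\<omega>\<in>space P. T \<omega> \<in> M \<rightarrow>\<^sub>M M) \<and>
     random_function M P M S T \<and>
     prob_space.indep_sets P (\<lambda>t. sets (shift_algebra P \<theta> t S)) \<T> \<and>
     (\<forall>t\<in>\<T>. random_map_law M P (\<lambda>\<omega>. T (\<theta> t \<omega>)) = random_map_law M P T)"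

text \<open>\<open>cocycle T \<theta> n \<omega>\<close> is the composition of the maps \<open>T (\<theta> i \<omega>)\<close>, \<open>i < n\<close>, with \<open>i = 0\<close>
  applied first.\<close>

primrec cocycle :: "('w \<Rightarrow> 'x \<Rightarrow> 'x) \<Rightarrow> (int \<Rightarrow> 'w \<Rightarrow> 'w) \<Rightarrow> nat \<Rightarrow> 'w \<Rightarrow> 'x \<Rightarrow> 'x" where
  "cocycle T \<theta> 0 \<omega> = id"
| "cocycle T \<theta> (Suc n) \<omega> = T (\<theta> (int n) \<omega>) \<circ> cocycle T \<theta> n \<omega>"

definition koopman ::
  "'w measure \<Rightarrow> ('w \<Rightarrow> 'x \<Rightarrow> 'x) \<Rightarrow> (int \<Rightarrow> 'w \<Rightarrow> 'w) \<Rightarrow> nat \<Rightarrow> ('x \<Rightarrow> complex) \<Rightarrow> 'x \<Rightarrow> complex" where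
  "koopman P T \<theta> t f x = (\<integral>\<omega>. f (cocycle T \<theta> t \<omega> x) \<partial>P)"

definition stationary ::
  "'x measure \<Rightarrow> 'w measure \<Rightarrow> ('w \<Rightarrow> 'x \<Rightarrow> 'x) \<Rightarrow> 'x measure \<Rightarrow> bool" where
  "stationary M P T \<mu> \<longleftrightarrow>
     prob_space \<mu> \<and> sets \<mu> = sets M \<and>
     (\<forall>A\<in>sets M. measure \<mu> A = (\<integral>x. (\<integral>\<omega>. indicat_real A (T \<omega> x) \<partial>P) \<partial>\<mu>))"

definition ergodic ::
  "'x measure \<Rightarrow> 'w measure \<Rightarrow> ('w \<Rightarrow> 'x \<Rightarrow> 'x) \<Rightarrow> 'x measure \<Rightarrow> bool" where
  "ergodic M P T \<mu> \<longleftrightarrow>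
     (\<forall>A\<in>sets M. (AE x in \<mu>. (\<integral>\<omega>. indicat_real A (T \<omega> x) \<partial>P) = indicat_real A x) \<longrightarrow>
        measure \<mu> A = 0 \<or> measure \<mu> A = 1)"

section \<open>Noisy observables\<close>

definition noisy_observable ::
  "'x measure \<Rightarrow> 'w measure \<Rightarrow> ('w \<Rightarrow> 'x \<Rightarrow> complex) \<Rightarrow> bool" where
  "noisy_observable M P h \<longleftrightarrow>
     (\<lambda>(x, \<omega>). h \<omega> x) \<in> borel_measurable (M \<Otimes>\<^sub>M P) \<and>
     (AE \<omega> in P. h \<omega> \<in> borel_measurable M)"

definition noisy_mean :: "'w measure \<Rightarrow> ('w \<Rightarrow> 'x \<Rightarrow> complex ^ 'n) \<Rightarrow> 'x \<Rightarrow> complex ^ 'n" where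
  "noisy_mean P h x = (\<chi> i. \<integral>\<omega>. h \<omega> x $ i \<partial>P)"

definition sample ::
  "('w \<Rightarrow> 'x \<Rightarrow> 'x) \<Rightarrow> (int \<Rightarrow> 'w \<Rightarrow> 'w) \<Rightarrow> ('w \<Rightarrow> 'x \<Rightarrow> complex ^ 'n) \<Rightarrow> 'x \<Rightarrow> 'w \<Rightarrow> nat \<Rightarrow> complex ^ 'n" where
  "sample T \<theta> h x\<^sub>0 \<omega>\<^sub>0 t = h (\<theta> (int t) \<omega>\<^sub>0) (cocycle T \<theta> t \<omega>\<^sub>0 x\<^sub>0)"

section \<open>Finite-dimensional subspaces of \<open>L\<^sup>2(\<mu>)\<close>\<close>

text \<open>
  Elements of \<open>L\<^sup>2(\<mu>)\<close> are represented by functions, and equality in \<open>L\<^sup>2(\<mu>)\<close> is equality almost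
  everywhere. A subspace is the set of all representatives of its elements; in particular
  \<open>L2_span\<close> is closed under almost everywhere equality.
\<close>

definition L2 :: "'x measure \<Rightarrow> ('x \<Rightarrow> complex) set" where
  "L2 \<mu> = {h \<in> borel_measurable \<mu>. integrable \<mu> (\<lambda>x. (norm (h x))\<^sup>2)}"

definition L2_span :: "'x measure \<Rightarrow> 'i set \<Rightarrow> ('i \<Rightarrow> 'x \<Rightarrow> complex) \<Rightarrow> ('x \<Rightarrow> complex) set" where
  "L2_span \<mu> I b = {h \<in> L2 \<mu>. \<exists>c. AE x in \<mu>. h x = (\<Sum>i\<in>I. c i * b i x)}"

definition L2_independent :: "'x measure \<Rightarrow> 'i set \<Rightarrow> ('i \<Rightarrow> 'x \<Rightarrow> complex) \<Rightarrow> bool" where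
  "L2_independent \<mu> I b \<longleftrightarrow>
     (\<forall>c. (AE x in \<mu>. (\<Sum>i\<in>I. c i * b i x) = 0) \<longrightarrow> (\<forall>i\<in>I. c i = 0))"

definition L2_has_dim :: "'x measure \<Rightarrow> ('x \<Rightarrow> complex) set \<Rightarrow> nat \<Rightarrow> bool" where
  "L2_has_dim \<mu> W d \<longleftrightarrow>
     (\<exists>b. (\<forall>i<d. b i \<in> L2 \<mu>) \<and> L2_independent \<mu> {..<d} b \<and> W = L2_span \<mu> {..<d} b)"

section \<open>Matrices\<close>

text \<open>Following the library, \<open>complex ^ 'l ^ 'k\<close> is the type of matrices with rows indexed by
  \<open>'k\<close> and columns indexed by \<open>'l\<close>.\<close>

definition ctranspose :: "complex ^ 'n ^ 'm \<Rightarrow> complex ^ 'm ^ 'n" where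
  "ctranspose A = (\<chi> i j. cnj (A $ j $ i))"

text \<open>The product \<open>v w\<^sup>*\<close> of a column vector and a conjugate-transposed column vector.\<close>

definition outer :: "complex ^ 'm \<Rightarrow> complex ^ 'n \<Rightarrow> complex ^ 'n ^ 'm" where
  "outer v w = (\<chi> i j. v $ i * cnj (w $ j))"

text \<open>The Moore--Penrose pseudoinverse, as the unique solution of the four Penrose equations.\<close>

definition pinv :: "complex ^ 'n ^ 'm \<Rightarrow> complex ^ 'm ^ 'n" where
  "pinv A = (THE B. A ** B ** A = A \<and> B ** A ** B = B \<and>
                    ctranspose (A ** B) = A ** B \<and> ctranspose (B ** A) = B ** A)"

definition empirical_correlation ::
  "('w \<Rightarrow> 'x \<Rightarrow> 'x) \<Rightarrow> (int \<Rightarrow> 'w \<Rightarrow> 'w) \<Rightarrow> ('w \<Rightarrow> 'x \<Rightarrow> complex ^ 'k) \<Rightarrow> ('w \<Rightarrow> 'x \<Rightarrow> complex ^ 'l) \<Rightarrow>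
   nat \<Rightarrow> nat \<Rightarrow> 'x \<Rightarrow> 'w \<Rightarrow> complex ^ 'l ^ 'k" where
  "empirical_correlation T \<theta> f g j n x\<^sub>0 \<omega>\<^sub>0 =
     (1 / real n) *\<^sub>R (\<Sum>m<n. outer (sample T \<theta> f x\<^sub>0 \<omega>\<^sub>0 (m + j)) (sample T \<theta> g x\<^sub>0 \<omega>\<^sub>0 m))"

text \<open>The output \<open>C\<^sub>n\<close> of noise resistant DMD; \<open>(1/n) X Z\<^sup>*\<close> and \<open>(1/n) Y Z\<^sup>*\<close>
  are the empirical correlations with lag \<open>0\<close> and \<open>1\<close>.\<close>

definition nr_dmd ::
  "('w \<Rightarrow> 'x \<Rightarrow> 'x) \<Rightarrow> (int \<Rightarrow> 'w \<Rightarrow> 'w) \<Rightarrow> ('w \<Rightarrow> 'x \<Rightarrow> complex ^ 'k) \<Rightarrow> ('w \<Rightarrow> 'x \<Rightarrow> complex ^ 'l) \<Rightarrow>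
   nat \<Rightarrow> 'x \<Rightarrow> 'w \<Rightarrow> complex ^ 'k ^ 'k" where
  "nr_dmd T \<theta> f g n x\<^sub>0 \<omega>\<^sub>0 =
     empirical_correlation T \<theta> f g 1 n x\<^sub>0 \<omega>\<^sub>0 ** pinv (empirical_correlation T \<theta> f g 0 n x\<^sub>0 \<omega>\<^sub>0)"

end

theory Submission
  imports Defs
begin

text \<open>
  For \<open>\<mu>\<close>-almost every fixed \<open>x\<close>, independence factors the noise average of the lag-\<open>j\<close> correlation into
  \<open>\<K>\<^sup>j f(x) g(x)\<^sup>*\<close>, so the limits \<open>G\<^sub>0\<close> and \<open>G\<^sub>1\<close> of the empirical correlations
  satisfy \<open>G\<^sub>0 = \<integral> f g\<^sup>* d\<mu>\<close> and \<open>G\<^sub>1 = K G\<^sub>0\<close>. If \<open>w\<^sup>* G\<^sub>0 = 0\<close>, then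
  \<open>w\<^sup>* f\<close> is orthogonal to all \<open>g\<^sub>j\<close> and lies in their span, hence vanishes, and \<open>w = 0\<close> by linear
  independence of the \<open>f\<^sub>i\<close>. Thus \<open>G\<^sub>0\<close> has full row rank. For such matrices
  \<open>A\<^sup>\<dagger> = A\<^sup>* (A A\<^sup>*)\<^sup>-\<^sup>1\<close>, which is continuous in \<open>A\<close>, so that \<open>C\<^sub>n\<close> converges to
  \<open>K G\<^sub>0 G\<^sub>0\<^sup>\<dagger> = K\<close>.
\<close>

section \<open>Explicit formulas for inverses and pseudoinverses\<close>

lemma ctranspose_matrix_mult: "ctranspose (A ** B) = ctranspose B ** ctranspose A"
  by (simp add: ctranspose_def matrix_matrix_mult_def vec_eq_iff mult.commute)

lemma ctranspose_ctranspose [simp]: "ctranspose (ctranspose A) = A"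
  by (simp add: ctranspose_def vec_eq_iff)

lemma ctranspose_mat_1 [simp]: "ctranspose (mat 1) = mat 1"
  by (simp add: ctranspose_def mat_def vec_eq_iff)

text \<open>Since \<open>ctranspose A ** N\<close> is a right inverse of \<open>A\<close>, three
  Penrose equations are immediate; the fourth holds because \<open>N\<close>, the inverse of a
  Hermitian matrix, is Hermitian. Uniqueness matters as well, because \<open>pinv\<close> is a
  definite description.\<close>

lemma pinv_full_row_rank:
  fixes A :: "complex ^ 'l ^ 'k" and N :: "complex ^ 'k ^ 'k"
  assumes N: "A ** ctranspose A ** N = mat 1"
  shows "pinv A = ctranspose A ** N"
proof -
  define H where "H = A ** ctranspose A"
  have HN: "H ** N = mat 1" and NH: "N ** H = mat 1"
    using N matrix_left_right_inverse unfolding H_def by blast+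
  have "ctranspose N ** H = mat 1"
    using arg_cong[OF HN, of ctranspose] by (simp add: H_def ctranspose_matrix_mult)
  then have hermitian: "ctranspose N = N"
    by (metis HN matrix_mul_assoc matrix_mul_lid matrix_mul_rid)
  have right_inverse: "A ** (ctranspose A ** N) = mat 1"
    using N by (simp add: matrix_mul_assoc)
  show ?thesis
    unfolding pinv_def
  proof (rule the_equality)
    show "A ** (ctranspose A ** N) ** A = A \<and>
      ctranspose A ** N ** A ** (ctranspose A ** N) = ctranspose A ** N \<and>
      ctranspose (A ** (ctranspose A ** N)) = A ** (ctranspose A ** N) \<and>
      ctranspose (ctranspose A ** N ** A) = ctranspose A ** N ** A"
      using right_inverse
      by (simp add: hermitian ctranspose_matrix_mult matrix_mul_assoc)
         (metis matrix_mul_assoc matrix_mul_rid)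
  next
    fix B
    assume B: "A ** B ** A = A \<and> B ** A ** B = B \<and>
      ctranspose (A ** B) = A ** B \<and> ctranspose (B ** A) = B ** A"
    \<comment> \<open>Multiplying \<open>A ** B ** A = A\<close> by the right inverse forces
      \<open>A ** B = mat 1\<close>. Symmetry of \<open>B ** A\<close> then turns
      \<open>B = B ** A ** B\<close> into \<open>ctranspose A ** (ctranspose B ** B)\<close>, and
      the second factor is a right inverse of \<open>H\<close>, hence \<open>N\<close>.\<close>
    have "A ** B ** (A ** (ctranspose A ** N)) = A ** (ctranspose A ** N)"
      using B by (simp add: matrix_mul_assoc)
    then have AB: "A ** B = mat 1"
      by (simp add: right_inverse)
    have BA: "B ** A = ctranspose A ** ctranspose B"
      using B by (simp add: ctranspose_matrix_mult)
    have B_eq: "B = ctranspose A ** (ctranspose B ** B)"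
      using B BA by (metis matrix_mul_assoc)
    then have "H ** (ctranspose B ** B) = mat 1"
      using AB by (metis H_def matrix_mul_assoc)
    then have "ctranspose B ** B = N"
      by (metis NH matrix_mul_assoc matrix_mul_lid matrix_mul_rid)
    then show "B = ctranspose A ** N"
      using B_eq by simp
  qed
qed

text \<open>Column \<open>j\<close> is Cramer's solution of \<open>H *v x = axis j 1\<close>. As a
  quotient of determinants it makes continuity in \<open>H\<close> visible. For singular
  \<open>H\<close> the division by zero yields the zero matrix.\<close>

definition cramer_inverse :: "complex ^ 'n ^ 'n \<Rightarrow> complex ^ 'n ^ 'n" where
  "cramer_inverse H =
     (\<chi> k j. det (\<chi> i m. if m = k then axis j 1 $ i else H $ i $ m) / det H)"

lemma cramer_inverse:
  assumes "det H \<noteq> 0"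
  shows "H ** cramer_inverse H = mat 1"
proof -
  have "H *v column j (cramer_inverse H) = axis j 1" for j
    using cramer[OF assms] by (simp add: column_def cramer_inverse_def)
  then have "(H ** cramer_inverse H) $ i $ j = axis j 1 $ i" for i j
    by (simp add: matrix_matrix_mult_def matrix_vector_mult_def column_def vec_eq_iff)
  then show ?thesis
    by (simp add: vec_eq_iff mat_def axis_def)
qed

section \<open>Continuity of matrix operations\<close>

lemma tendsto_matrix_nth:
  fixes X :: "'a \<Rightarrow> complex ^ 'n ^ 'm"
  shows "(X \<longlongrightarrow> A) F \<Longrightarrow> ((\<lambda>t. X t $ i $ j) \<longlongrightarrow> A $ i $ j) F"
  by (intro tendsto_vec_nth)

lemma tendsto_det:
  fixes X :: "'a \<Rightarrow> complex ^ 'n ^ 'n"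
  assumes "(X \<longlongrightarrow> A) F"
  shows "((\<lambda>t. det (X t)) \<longlongrightarrow> det A) F"
  unfolding det_def by (intro tendsto_intros tendsto_matrix_nth assms)

lemma tendsto_matrix_matrix_mult:
  fixes X :: "'a \<Rightarrow> complex ^ 'n ^ 'm" and Y :: "'a \<Rightarrow> complex ^ 'l ^ 'n"
  assumes "(X \<longlongrightarrow> A) F" "(Y \<longlongrightarrow> B) F"
  shows "((\<lambda>t. X t ** Y t) \<longlongrightarrow> A ** B) F"
  unfolding matrix_matrix_mult_def by (intro tendsto_intros tendsto_matrix_nth assms)

lemma tendsto_ctranspose:
  assumes "(X \<longlongrightarrow> A) F"
  shows "((\<lambda>t. ctranspose (X t)) \<longlongrightarrow> ctranspose A) F"
  unfolding ctranspose_def by (intro tendsto_intros tendsto_matrix_nth assms)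

lemma tendsto_cramer_inverse:
  assumes "(X \<longlongrightarrow> H) F" "det H \<noteq> 0"
  shows "((\<lambda>t. cramer_inverse (X t)) \<longlongrightarrow> cramer_inverse H) F"
proof -
  have "((\<lambda>t. if m = k then axis j 1 $ i else X t $ i $ m) \<longlongrightarrow>
      (if m = k then axis j 1 $ i else H $ i $ m)) F" for i j k m
    using tendsto_matrix_nth[OF assms(1)] by simp
  then show ?thesis
    unfolding cramer_inverse_def by (intro tendsto_intros tendsto_det assms)
qed

text \<open>If \<open>A ** ctranspose A\<close> kills \<open>v\<close>, pairing with
  \<open>v\<close> shows that the squared norm of \<open>ctranspose A *v v\<close> is zero, so
  \<open>v = 0\<close> by assumption. A square matrix with trivial kernel is invertible.\<close>

lemma det_gram_nonzero:
  fixes A :: "complex ^ 'l ^ 'k"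
  assumes "\<And>v. ctranspose A *v v = 0 \<Longrightarrow> v = 0"
  shows "det (A ** ctranspose A) \<noteq> 0"
proof -
  have "v = 0" if v: "(A ** ctranspose A) *v v = 0" for v
  proof -
    define w where "w = ctranspose A *v v"
    have "A *v w = 0"
      using v by (simp add: w_def matrix_vector_mul_assoc)
    then have "0 = (\<Sum>i\<in>UNIV. cnj (v $ i) * (A *v w) $ i)"
      by simp
    also have "\<dots> = (\<Sum>j\<in>UNIV. (\<Sum>i\<in>UNIV. cnj (v $ i) * A $ i $ j) * w $ j)"
      by (simp add: matrix_vector_mult_def sum_distrib_left sum_distrib_right mult.assoc)
         (rule sum.swap)
    also have "\<dots> = (\<Sum>j\<in>UNIV. cnj (w $ j) * w $ j)"
      by (simp add: w_def matrix_vector_mult_def ctranspose_def mult.commute)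
    also have "\<dots> = of_real (\<Sum>j\<in>UNIV. (norm (w $ j))\<^sup>2)"
      by (simp only: of_real_sum complex_norm_square mult.commute)
    finally have "(\<Sum>j\<in>UNIV. (norm (w $ j))\<^sup>2) = 0"
      by (metis of_real_eq_0_iff)
    then have "w = 0"
      by (simp add: sum_nonneg_eq_0_iff vec_eq_iff)
    then show ?thesis
      using assms by (simp add: w_def)
  qed
  then have "\<exists>B. B ** (A ** ctranspose A) = mat 1"
    by (auto simp: matrix_left_invertible_ker)
  then show ?thesis
    by (simp add: invertible_left_inverse flip: invertible_det_nz)
qed

text \<open>The pseudoinverse is discontinuous where the rank jumps. At \<open>A\<close> the Gram
  determinant is nonzero, which is an open condition, so near the limit \<open>pinv\<close> is given
  by a continuous formula.\<close>

lemma tendsto_mult_pinv: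
  fixes A :: "complex ^ 'l ^ 'k" and K :: "complex ^ 'k ^ 'm"
  assumes X: "(X \<longlongrightarrow> A) F" and Y: "(Y \<longlongrightarrow> K ** A) F"
    and A: "\<And>v. ctranspose A *v v = 0 \<Longrightarrow> v = 0"
  shows "((\<lambda>t. Y t ** pinv (X t)) \<longlongrightarrow> K) F"
proof -
  define gram where "gram B = B ** ctranspose B" for B :: "complex ^ 'l ^ 'k"
  have gram: "((\<lambda>t. gram (X t)) \<longlongrightarrow> gram A) F"
    unfolding gram_def by (intro tendsto_matrix_matrix_mult tendsto_ctranspose X)
  have det: "det (gram A) \<noteq> 0"
    unfolding gram_def using A by (rule det_gram_nonzero)
  have pinv: "pinv B = ctranspose B ** cramer_inverse (gram B)" if "det (gram B) \<noteq> 0" for B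
    using cramer_inverse[OF that] by (intro pinv_full_row_rank) (simp add: gram_def)
  have "((\<lambda>t. Y t ** (ctranspose (X t) ** cramer_inverse (gram (X t)))) \<longlongrightarrow>
      K ** A ** (ctranspose A ** cramer_inverse (gram A))) F"
    by (intro tendsto_matrix_matrix_mult tendsto_ctranspose tendsto_cramer_inverse X Y gram det)
  moreover have "K ** A ** (ctranspose A ** cramer_inverse (gram A)) = K"
    using cramer_inverse[OF det]
    by (metis gram_def matrix_mul_assoc matrix_mul_rid)
  \<comment> \<open>Individual \<open>X t\<close> may be rank deficient; the formula for
    \<open>pinv (X t)\<close> holds only eventually, which suffices for the limit.\<close>
  moreover have "\<forall>\<^sub>F t in F. Y t ** (ctranspose (X t) ** cramer_inverse (gram (X t))) = Y t ** pinv (X t)"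
    using tendsto_imp_eventually_ne[OF tendsto_det[OF gram] det]
    by eventually_elim (simp add: pinv)
  ultimately show ?thesis
    using tendsto_cong by fastforce
qed

section \<open>Square-integrable functions and linear independence\<close>

lemma borel_measurable_cnj [measurable (raw)]:
  "u \<in> borel_measurable N \<Longrightarrow> (\<lambda>x. cnj (u x)) \<in> borel_measurable N"
  by (rule borel_measurable_continuous_on) (intro continuous_intros)

lemma L2_integrable_mult_cnj:
  assumes "u \<in> L2 \<mu>" "v \<in> L2 \<mu>"
  shows "integrable \<mu> (\<lambda>x. u x * cnj (v x))"
proof (rule Bochner_Integration.integrable_bound)
  show "integrable \<mu> (\<lambda>x. (norm (u x))\<^sup>2 + (norm (v x))\<^sup>2)"
    using assms by (simp add: L2_def)
  show "(\<lambda>x. u x * cnj (v x)) \<in> borel_measurable \<mu>"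
    using assms by (auto simp: L2_def intro!: borel_measurable_times borel_measurable_cnj)
  have "norm (u x * cnj (v x)) \<le> norm ((norm (u x))\<^sup>2 + (norm (v x))\<^sup>2)" for x
  proof -
    have "0 \<le> norm (u x) * norm (v x)"
      by simp
    then show ?thesis
      using sum_squares_bound[of "norm (u x)" "norm (v x)"] unfolding norm_mult complex_mod_cnj
      by (simp add: abs_of_nonneg del: mult_nonneg_nonneg)
  qed
  then show "AE x in \<mu>. norm (u x * cnj (v x)) \<le> norm ((norm (u x))\<^sup>2 + (norm (v x))\<^sup>2)"
    by simp
qed

text \<open>The product of the sum with its conjugate expands into finitely many terms
  \<open>b i x * cnj (b j x)\<close> with constant coefficients, each integrable by the previous
  lemma.\<close>

lemma L2_sum:
  assumes "finite I" "\<And>i. i \<in> I \<Longrightarrow> b i \<in> L2 \<mu>"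
  shows "(\<lambda>x. \<Sum>i\<in>I. c i * b i x) \<in> L2 \<mu>"
proof -
  define s where "s x = (\<Sum>i\<in>I. c i * b i x)" for x
  have "integrable \<mu> (\<lambda>x. s x * cnj (s x))"
    unfolding s_def cnj_sum complex_cnj_mult sum_product
    using assms(2) L2_integrable_mult_cnj[of "b i" \<mu> "b j" for i j]
    by (intro Bochner_Integration.integrable_sum)
       (simp add: mult.left_commute[of "b _ _"] mult.assoc)
  from integrable_norm[OF this] have "integrable \<mu> (\<lambda>x. (norm (s x))\<^sup>2)"
    by (simp add: norm_mult power2_eq_square)
  moreover have "s \<in> borel_measurable \<mu>"
    unfolding s_def using assms(2)
    by (auto simp: L2_def intro!: borel_measurable_sum borel_measurable_times)
  ultimately show ?thesis
    by (simp add: L2_def s_def[abs_def])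
qed

text \<open>Two spanning families of equal size are related by square matrices, so that a one-sided
  inverse relation between them is two-sided.\<close>

lemma L2_independent_if_dim:
  fixes u :: "'n::finite \<Rightarrow> 'x \<Rightarrow> complex"
  assumes u: "\<And>i. u i \<in> L2 \<mu>" and dim: "L2_has_dim \<mu> (L2_span \<mu> UNIV u) CARD('n)"
  shows "L2_independent \<mu> UNIV u"
proof -
  obtain b where b: "\<And>i. i < CARD('n) \<Longrightarrow> b i \<in> L2 \<mu>"
    and indep: "L2_independent \<mu> {..<CARD('n)} b"
    and span: "L2_span \<mu> UNIV u = L2_span \<mu> {..<CARD('n)} b"
    using dim by (auto simp: L2_has_dim_def)
  \<comment> \<open>Reindexing the basis \<open>b\<close> by the type \<open>'n\<close> makes both
    coefficient matrices below square over the same index type.\<close>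
  obtain e where e: "bij_betw e (UNIV :: 'n set) {..<CARD('n)}"
    using ex_bij_betw_finite_nat[of "UNIV :: 'n set"] by (auto simp: lessThan_atLeast0)
  have e_less: "e i < CARD('n)" for i
    using e by (auto simp: bij_betw_def)
  have sum_e: "(\<Sum>i<CARD('n). h i) = (\<Sum>i\<in>UNIV. h (e i))" for h :: "nat \<Rightarrow> complex"
    using sum.reindex_bij_betw[OF e] by metis
  have "b (e i) \<in> L2_span \<mu> {..<CARD('n)} b" for i
  proof -
    have "b (e i) x = (\<Sum>j<CARD('n). (if j = e i then 1 else 0) * b j x)" for x
      using e_less by (simp add: if_distrib[of "\<lambda>c. c * _"] cong: if_cong)
    then show ?thesis
      using b[OF e_less] unfolding L2_span_def by auto
  qed
  then have "\<exists>c. AE x in \<mu>. b (e i) x = (\<Sum>j\<in>UNIV. c j * u j x)" for i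
    unfolding span[symmetric] by (simp add: L2_span_def)
  then obtain a where a: "\<And>i. AE x in \<mu>. b (e i) x = (\<Sum>j\<in>UNIV. a i j * u j x)"
    by metis
  have "u i \<in> L2_span \<mu> UNIV u" for i
  proof -
    have "u i x = (\<Sum>j\<in>UNIV. (if j = i then 1 else 0) * u j x)" for x
      by (simp add: if_distrib[of "\<lambda>c. c * _"] cong: if_cong)
    then show ?thesis
      using u unfolding L2_span_def by auto
  qed
  then have "\<exists>c. AE x in \<mu>. u i x = (\<Sum>j<CARD('n). c j * b j x)" for i
    unfolding span by (simp add: L2_span_def)
  then obtain d where d: "\<And>i. AE x in \<mu>. u i x = (\<Sum>j\<in>UNIV. d i (e j) * b (e j) x)"
    unfolding sum_e by metis
  have b_indep: "c = 0" if "AE x in \<mu>. (\<Sum>j\<in>UNIV. c $ j * b (e j) x) = 0" for c :: "complex ^ 'n"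
  proof -
    have "(\<Sum>i<CARD('n). c $ inv e i * b i x) = (\<Sum>j\<in>UNIV. c $ j * b (e j) x)" for x
      using e by (simp add: sum_e bij_betw_def)
    then have "\<forall>i<CARD('n). c $ inv e i = 0"
      using indep[unfolded L2_independent_def, rule_format, of "\<lambda>i. c $ inv e i"] that by auto
    then have "c $ inv e (e j) = 0" for j
      using e_less by blast
    then show ?thesis
      using e by (simp add: bij_betw_def vec_eq_iff)
  qed
  define A :: "complex ^ 'n ^ 'n" where "A = (\<chi> i j. a i j)"
  define D :: "complex ^ 'n ^ 'n" where "D = (\<chi> i j. d i (e j))"
  have "AE x in \<mu>. \<forall>i. u i x = (\<Sum>j\<in>UNIV. d i (e j) * b (e j) x)"
    using d by (simp add: AE_all_countable)
  then have ud: "AE x in \<mu>. (\<chi> i. u i x) = D *v (\<chi> j. b (e j) x)"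
    by eventually_elim (simp add: D_def vec_eq_iff matrix_vector_mult_def)
  have "AE x in \<mu>. \<forall>i. b (e i) x = (\<Sum>j\<in>UNIV. a i j * u j x)"
    using a by (simp add: AE_all_countable)
  then have "AE x in \<mu>. (\<chi> j. b (e j) x) = A *v (\<chi> i. u i x)"
    by eventually_elim (simp add: A_def vec_eq_iff matrix_vector_mult_def)
  \<comment> \<open>Almost everywhere the basis vector equals \<open>A ** D\<close> applied to
    itself. Independence of the basis, applied row by row, gives \<open>A ** D = mat 1\<close>;
    squareness then gives \<open>D ** A = mat 1\<close>.\<close>
  with ud have "AE x in \<mu>. (A ** D - mat 1) *v (\<chi> j. b (e j) x) = 0"
    by eventually_elim (simp add: matrix_vector_mult_diff_rdistrib flip: matrix_vector_mul_assoc)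
  then have "(A ** D - mat 1) $ i = 0" for i
    by (intro b_indep, eventually_elim) (simp add: matrix_vector_mult_def vec_eq_iff)
  then have "A ** D = mat 1"
    by (metis eq_iff_diff_eq_0 vec_eq_iff zero_index)
  then have DA: "D ** A = mat 1"
    using matrix_left_right_inverse by blast
  show ?thesis
    unfolding L2_independent_def
  proof (intro allI impI)
    fix c :: "'n \<Rightarrow> complex"
    assume c: "AE x in \<mu>. (\<Sum>i\<in>UNIV. c i * u i x) = 0"
    \<comment> \<open>A relation \<open>c\<close> among the \<open>u i\<close> becomes the relation
      \<open>vec_lambda c v* D\<close> among the basis functions. The latter vanishes, and
      multiplying by \<open>A\<close> on the right recovers \<open>c = 0\<close>.\<close>
    have "(\<Sum>j\<in>UNIV. (vec_lambda c v* D) $ j * v $ j) = (\<Sum>i\<in>UNIV. c i * (D *v v) $ i)" for v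
      by (simp add: vector_matrix_mult_def matrix_vector_mult_def sum_distrib_left
          sum_distrib_right mult_ac) (rule sum.swap)
    note cD = this[of "\<chi> j. b (e j) x" for x, simplified]
    have "vec_lambda c v* D = 0"
    proof (rule b_indep)
      show "AE x in \<mu>. (\<Sum>j\<in>UNIV. (vec_lambda c v* D) $ j * b (e j) x) = 0"
        using c ud
      proof eventually_elim
        case (elim x)
        have "u i x = (D *v (\<chi> j. b (e j) x)) $ i" for i
          using elim(2) by (metis vec_lambda_beta)
        then show ?case
          using elim(1) cD by simp
      qed
    qed
    then have "vec_lambda c v* (D ** A) = 0"
      by (simp flip: vector_matrix_mul_assoc)
    then have "vec_lambda c = 0"
      by (simp add: DA)
    then show "\<forall>i\<in>UNIV. c i = 0"
      by (metis vec_lambda_beta zero_index)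
  qed
qed

section \<open>Independence, sub-\<sigma>-algebras and random functions\<close>

lemma (in prob_space) indep_set_integral_mult_cnj:
  fixes u v :: "'a \<Rightarrow> complex"
  assumes indep: "indep_set (sets A) (sets B)" and sub: "subalgebra M A" "subalgebra M B"
    and u: "u \<in> borel_measurable B" "integrable M u"
    and v: "v \<in> borel_measurable A" "integrable M v"
  shows "(\<integral>\<omega>. u \<omega> * cnj (v \<omega>) \<partial>M) = (\<integral>\<omega>. u \<omega> \<partial>M) * cnj (\<integral>\<omega>. v \<omega> \<partial>M)"
proof -
  \<comment> \<open>A function measurable for a subalgebra generates a \<sigma>-algebra inside it.
    Thus independence of \<open>A\<close> and \<open>B\<close> passes to the random variables, and
    the expectation of their product factors.\<close>
  have sub': "sigma_sets (space M) {w -` C \<inter> space M | C. C \<in> sets borel} \<subseteq> sets N"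
    if "subalgebra M N" "w \<in> borel_measurable N" for N and w :: "'a \<Rightarrow> complex"
  proof -
    have "{w -` C \<inter> space N | C. C \<in> sets borel} \<subseteq> sets N"
      using that(2) by (auto simp: measurable_sets)
    from sets.sigma_sets_subset[OF this] show ?thesis
      using that(1) by (simp add: subalgebra_def)
  qed
  have v': "(\<lambda>\<omega>. cnj (v \<omega>)) \<in> borel_measurable A"
    using v(1) by measurable
  have "indep_var borel (\<lambda>\<omega>. cnj (v \<omega>)) borel u"
    unfolding indep_var_eq
  proof (intro conjI indep_setI)
    show "random_variable borel (\<lambda>\<omega>. cnj (v \<omega>))" "random_variable borel u"
      using measurable_from_subalg[OF sub(1) v'] measurable_from_subalg[OF sub(2) u(1)] by auto
    show "sigma_sets (space M) {(\<lambda>\<omega>. cnj (v \<omega>)) -` C \<inter> space M | C. C \<in> sets borel} \<subseteq> events"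
      "sigma_sets (space M) {u -` C \<inter> space M | C. C \<in> sets borel} \<subseteq> events"
      using sub'[OF sub(1) v'] sub'[OF sub(2) u(1)] sub unfolding subalgebra_def by blast+
    show "prob (a \<inter> b) = prob a * prob b"
      if "a \<in> sigma_sets (space M) {(\<lambda>\<omega>. cnj (v \<omega>)) -` C \<inter> space M | C. C \<in> sets borel}"
        "b \<in> sigma_sets (space M) {u -` C \<inter> space M | C. C \<in> sets borel}" for a b
      using sub'[OF sub(1) v'] sub'[OF sub(2) u(1)] that
      by (intro indep_setD[OF indep]) (rule subsetD, assumption+)+
  qed
  from indep_var_lebesgue_integral[OF this] show ?thesis
    using u v by (simp add: mult.commute)
qed

lemma sets_joint_algebra:
  assumes "\<And>S. S \<in> \<S> \<Longrightarrow> subalgebra P S"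
  shows "sets (joint_algebra P \<S>) = sigma_sets (space P) (\<Union>S\<in>\<S>. sets S)"
  unfolding joint_algebra_def
proof (rule sets_measure_of)
  show "(\<Union>S\<in>\<S>. sets S) \<subseteq> Pow (space P)"
    using assms sets.space_closed[of P] unfolding subalgebra_def by blast
qed

lemma subalgebra_joint_algebra:
  assumes "\<And>S. S \<in> \<S> \<Longrightarrow> subalgebra P S"
  shows "subalgebra P (joint_algebra P \<S>)"
proof -
  have "(\<Union>S\<in>\<S>. sets S) \<subseteq> sets P"
    using assms by (auto simp: subalgebra_def)
  from sets.sigma_sets_subset[OF this] show ?thesis
    using sets_joint_algebra[of \<S> P] assms
    by (simp add: subalgebra_def joint_algebra_def space_measure_of_conv)
qed

lemma subalgebra_of_joint_algebra:
  assumes "\<And>S. S \<in> \<S> \<Longrightarrow> subalgebra P S" "S \<in> \<S>"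
  shows "subalgebra (joint_algebra P \<S>) S"
proof -
  have "sets S \<subseteq> sets (joint_algebra P \<S>)"
    using assms(2) by (subst sets_joint_algebra[OF assms(1)]) auto
  then show ?thesis
    using assms by (simp add: joint_algebra_def space_measure_of_conv subalgebra_def)
qed

lemma subalgebra_shift_algebra:
  assumes "\<theta> t \<in> P \<rightarrow>\<^sub>M P" "subalgebra P S"
  shows "subalgebra P (shift_algebra P \<theta> t S)"
proof -
  have "\<theta> t \<in> space P \<rightarrow> space S"
    using assms by (auto simp: subalgebra_def dest: measurable_space)
  then show ?thesis
    using assms
    by (auto simp: subalgebra_def shift_algebra_def sets_vimage_algebra2 measurable_sets)
qed

lemma measurable_shift_algebra:
  assumes "\<theta> t \<in> P \<rightarrow>\<^sub>M P" "subalgebra P S"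
  shows "\<theta> t \<in> shift_algebra P \<theta> t S \<rightarrow>\<^sub>M S"
  unfolding shift_algebra_def
  by (rule measurable_vimage_algebra1)
     (use assms in \<open>auto simp: subalgebra_def dest: measurable_space\<close>)

text \<open>Joint measurability in state and noise allows both arguments to be random: the function
  is composed with the pair \<open>(X, \<phi>)\<close>. This is what makes a sample at the moved
  state \<open>T \<omega> x\<close> measurable.\<close>

lemma random_function_measurable_comp:
  assumes "random_function M P N S h" "X \<in> A \<rightarrow>\<^sub>M M" "\<phi> \<in> A \<rightarrow>\<^sub>M S"
  shows "(\<lambda>\<omega>. h (\<phi> \<omega>) (X \<omega>)) \<in> A \<rightarrow>\<^sub>M N"
proof -
  have "(\<lambda>\<omega>. (X \<omega>, \<phi> \<omega>)) \<in> A \<rightarrow>\<^sub>M M \<Otimes>\<^sub>M S"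
    using assms(2,3) by (rule measurable_Pair)
  moreover have "(\<lambda>(x, \<omega>). h \<omega> x) \<in> M \<Otimes>\<^sub>M S \<rightarrow>\<^sub>M N"
    using assms(1) by (simp add: random_function_def)
  ultimately have "(\<lambda>\<omega>. (\<lambda>(x, \<omega>). h \<omega> x) (X \<omega>, \<phi> \<omega>)) \<in> A \<rightarrow>\<^sub>M N"
    by (rule measurable_compose)
  then show ?thesis
    by simp
qed

section \<open>Full rank of the cross-correlation matrix\<close>

lemma L2_gram_full_rank:
  fixes u :: "'m::finite \<Rightarrow> 'x \<Rightarrow> complex" and v :: "'n::finite \<Rightarrow> 'x \<Rightarrow> complex"
  assumes u: "\<And>i. u i \<in> L2 \<mu>" and v: "\<And>j. v j \<in> L2 \<mu>"
    and indep: "L2_independent \<mu> UNIV u"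
    and span: "L2_span \<mu> UNIV u \<subseteq> L2_span \<mu> UNIV v"
    and w: "ctranspose (\<chi> i j. \<integral>x. u i x * cnj (v j x) \<partial>\<mu>) *v w = 0"
  shows "w = 0"
proof -
  \<comment> \<open>The assumption on \<open>w\<close> says that \<open>h\<close> is orthogonal to
    every \<open>v j\<close>, while \<open>span\<close> places \<open>h\<close> among their
    combinations. Hence \<open>h\<close> is orthogonal to itself and vanishes almost
    everywhere.\<close>
  define h where "h x = (\<Sum>i\<in>UNIV. cnj (w $ i) * u i x)" for x
  have h: "h \<in> L2 \<mu>"
    unfolding h_def by (intro L2_sum u) simp
  have orth: "(\<integral>x. h x * cnj (v j x) \<partial>\<mu>) = 0" for j
  proof -
    have "(\<integral>x. h x * cnj (v j x) \<partial>\<mu>) =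
        (\<integral>x. (\<Sum>i\<in>UNIV. cnj (w $ i) * (u i x * cnj (v j x))) \<partial>\<mu>)"
      by (simp add: h_def sum_distrib_right mult.assoc)
    also have "\<dots> = (\<Sum>i\<in>UNIV. cnj (w $ i) * (\<integral>x. u i x * cnj (v j x) \<partial>\<mu>))"
      using L2_integrable_mult_cnj[OF u v] by simp
    also have "\<dots> = cnj ((ctranspose (\<chi> i j. \<integral>x. u i x * cnj (v j x) \<partial>\<mu>) *v w) $ j)"
      by (simp add: matrix_vector_mult_def ctranspose_def mult.commute)
    finally show ?thesis
      by (simp add: w)
  qed
  have "h \<in> L2_span \<mu> UNIV u"
    using h by (auto simp: L2_span_def h_def)
  then obtain c where c: "AE x in \<mu>. h x = (\<Sum>j\<in>UNIV. c j * v j x)"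
    using span by (auto simp: L2_span_def)
  have int: "integrable \<mu> (\<lambda>x. h x * cnj (v j x))" for j
    using h v by (rule L2_integrable_mult_cnj)
  have "of_real (\<integral>x. (norm (h x))\<^sup>2 \<partial>\<mu>) = (\<integral>x. h x * cnj (h x) \<partial>\<mu>)"
    by (simp only: complex_norm_square[symmetric] integral_complex_of_real)
  \<comment> \<open>Only the conjugated factor is expanded in the \<open>v j\<close>, so that each
    term contains an integral already known to be zero.\<close>
  also have "\<dots> = (\<integral>x. (\<Sum>j\<in>UNIV. cnj (c j) * (h x * cnj (v j x))) \<partial>\<mu>)"
  proof (rule integral_cong_AE)
    show "AE x in \<mu>. h x * cnj (h x) = (\<Sum>j\<in>UNIV. cnj (c j) * (h x * cnj (v j x)))"
      using c
    proof eventually_elim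
      case (elim x)
      then have "cnj (h x) = (\<Sum>j\<in>UNIV. cnj (c j) * cnj (v j x))"
        by simp
      then show ?case
        by (simp add: sum_distrib_left mult.left_commute)
    qed
  qed (use L2_integrable_mult_cnj[OF h h] int in auto)
  also have "\<dots> = 0"
    using int by (simp add: orth)
  finally have "(\<integral>x. (norm (h x))\<^sup>2 \<partial>\<mu>) = 0"
    by simp
  then have "AE x in \<mu>. h x = 0"
    using h by (simp add: L2_def integral_nonneg_eq_0_iff_AE)
  then have "\<forall>i\<in>UNIV. cnj (w $ i) = 0"
    using indep[unfolded L2_independent_def, rule_format, of "\<lambda>i. cnj (w $ i)"]
    unfolding h_def by blast
  then show ?thesis
    by (simp add: vec_eq_iff)
qed

theorem proposition5p2:
  fixes M :: "'x measure" and P :: "'w measure" and \<mu> :: "'x measure"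
    and \<T> :: "int set" and \<theta> :: "int \<Rightarrow> 'w \<Rightarrow> 'w" and T :: "'w \<Rightarrow> 'x \<Rightarrow> 'x"
    and ft :: "'w \<Rightarrow> 'x \<Rightarrow> complex ^ 'k" and gt :: "'w \<Rightarrow> 'x \<Rightarrow> complex ^ 'l"
    and ST :: "'w measure" and Sf :: "'k \<Rightarrow> 'w measure" and Sg :: "'l \<Rightarrow> 'w measure"
    and f :: "'x \<Rightarrow> complex ^ 'k" and g :: "'x \<Rightarrow> complex ^ 'l"
    and F :: "('x \<Rightarrow> complex) set"
    and K :: "complex ^ 'k ^ 'k"
  assumes P: "prob_space P"
    and \<theta>: "measure_preserving_action \<T> P \<theta>"
    and T: "iid_random_system M P \<T> \<theta> ST T"
    and \<mu>: "stationary M P T \<mu>" "ergodic M P T \<mu>"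
    and kl: "CARD('k) \<le> CARD('l)"
    and ft: "\<And>i. noisy_observable M P (\<lambda>\<omega> x. ft \<omega> x $ i)"
            "\<And>i. random_function M P borel (Sf i) (\<lambda>\<omega> x. ft \<omega> x $ i)"
    and gt: "\<And>i. noisy_observable M P (\<lambda>\<omega> x. gt \<omega> x $ i)"
            "\<And>i. random_function M P borel (Sg i) (\<lambda>\<omega> x. gt \<omega> x $ i)"
    and f_mean: "\<And>i. AE x in \<mu>. integrable P (\<lambda>\<omega>. ft \<omega> x $ i)" "f = noisy_mean P ft"
    and g_mean: "\<And>i. AE x in \<mu>. integrable P (\<lambda>\<omega>. gt \<omega> x $ i)" "g = noisy_mean P gt"
    and f_L2: "\<And>i. (\<lambda>x. f x $ i) \<in> L2 \<mu>"
    and g_L2: "\<And>i. (\<lambda>x. g x $ i) \<in> L2 \<mu>"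
    and correlations_integrable:
      "\<And>j a b. integrable (\<mu> \<Otimes>\<^sub>M P)
         (\<lambda>(x, \<omega>). outer (ft (\<theta> (int j) \<omega>) (cocycle T \<theta> j \<omega> x)) (gt \<omega> x) $ a $ b)"
    and correlations_converge:
      "\<And>j. AE (x\<^sub>0, \<omega>\<^sub>0) in \<mu> \<Otimes>\<^sub>M P.
         (\<lambda>n. empirical_correlation T \<theta> ft gt j n x\<^sub>0 \<omega>\<^sub>0) \<longlonglongrightarrow>
           (\<chi> a b. \<integral>x. (\<integral>\<omega>. outer (ft (\<theta> (int j) \<omega>) (cocycle T \<theta> j \<omega> x)) (gt \<omega> x) $ a $ b \<partial>P) \<partial>\<mu>)"
    and koopman_mean:
      "\<And>j i. AE x in \<mu>. has_bochner_integral P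
         (\<lambda>\<omega>. ft (\<theta> (int j) \<omega>) (cocycle T \<theta> j \<omega> x) $ i)
         (koopman P T \<theta> j (\<lambda>y. f y $ i) x)"
    and indep:
      "prob_space.indep_set P
         (sets (joint_algebra P (range Sg)))
         (sets (joint_algebra P (range Sf \<union> shift_algebra P \<theta> 1 ` range Sf \<union> {ST})))"
    and F: "F = L2_span \<mu> UNIV (\<lambda>i x. f x $ i)"
    and F_dim: "L2_has_dim \<mu> F CARD('k)"
    and F_invariant: "\<And>h. h \<in> F \<Longrightarrow> koopman P T \<theta> 1 h \<in> F"
    and F_span: "F \<subseteq> L2_span \<mu> UNIV (\<lambda>i x. g x $ i)"
    and K: "AE x in \<mu>. K *v f x = (\<chi> i. koopman P T \<theta> 1 (\<lambda>y. f y $ i) x)"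
  shows "AE (x\<^sub>0, \<omega>\<^sub>0) in \<mu> \<Otimes>\<^sub>M P. (\<lambda>n. nr_dmd T \<theta> ft gt n x\<^sub>0 \<omega>\<^sub>0) \<longlonglongrightarrow> K"
proof -
  interpret P: prob_space P by fact
  have sets_\<mu>: "sets \<mu> = sets M"
    using \<mu>(1) by (simp add: stationary_def)
  have space_\<mu>: "space \<mu> = space M"
    using sets_\<mu> by (rule sets_eq_imp_space_eq)
  have \<T>: "0 \<in> \<T>" "1 \<in> \<T>"
    using \<theta> by (auto simp: measure_preserving_action_def)
  have \<theta>0: "\<theta> 0 \<omega> = \<omega>" if "\<omega> \<in> space P" for \<omega>
    using \<theta> that by (simp add: measure_preserving_action_def)
  have \<theta>1: "\<theta> 1 \<in> P \<rightarrow>\<^sub>M P"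
    using \<theta> \<T> by (simp add: measure_preserving_action_def)
  have Sf: "subalgebra P (Sf i)" and Sg: "subalgebra P (Sg j)" for i j
    using ft(2) gt(2) by (auto simp: random_function_def)
  have ST: "random_function M P M ST T" "subalgebra P ST"
    using T by (auto simp: iid_random_system_def random_function_def)

  \<comment> \<open>The two independent noise algebras and the samples they carry\<close>
  define \<S> where "\<S> = range Sf \<union> shift_algebra P \<theta> 1 ` range Sf \<union> {ST}"
  \<comment> \<open>\<open>A\<close> carries the noise of \<open>gt\<close>; \<open>B\<close>
    carries that of \<open>ft\<close>, of its shift by \<open>\<theta> 1\<close> and of
    \<open>T\<close>. Their independence is the hypothesis \<open>indep\<close>.\<close>
  define A where "A = joint_algebra P (range Sg)"
  define B where "B = joint_algebra P \<S>"
  have sub_\<S>: "subalgebra P S" if "S \<in> \<S>" for S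
    using that Sf ST(2) subalgebra_shift_algebra[where \<theta>=\<theta> and t=1, OF \<theta>1 Sf] by (auto simp: \<S>_def)
  have sub: "subalgebra P A" "subalgebra P B"
    unfolding A_def B_def using Sg sub_\<S> by (auto intro!: subalgebra_joint_algebra)
  have sub_A: "subalgebra A (Sg j)" for j
    unfolding A_def using Sg by (intro subalgebra_of_joint_algebra) auto
  have sub_B: "subalgebra B S" if "S \<in> \<S>" for S
    unfolding B_def using sub_\<S> that by (rule subalgebra_of_joint_algebra)
  have ident: "(\<lambda>\<omega>. \<omega>) \<in> N \<rightarrow>\<^sub>M S" if "subalgebra N S" for N S :: "'w measure"
    using measurable_from_subalg[OF that measurable_ident] by (simp add: id_def)
  have spaces: "space A = space P" "space B = space P"
    using sub by (auto simp: subalgebra_def)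

  have gt_A: "(\<lambda>\<omega>. gt \<omega> x $ j) \<in> borel_measurable A" if "x \<in> space M" for x j
    using that random_function_measurable_comp[OF gt(2) _ ident[OF sub_A]] by auto
  have ft_B: "(\<lambda>\<omega>. ft \<omega> x $ i) \<in> borel_measurable B" if "x \<in> space M" for x i
    using that random_function_measurable_comp[OF ft(2) _ ident[OF sub_B]]
    by (auto simp: \<S>_def)
  have T_B: "(\<lambda>\<omega>. T \<omega> x) \<in> B \<rightarrow>\<^sub>M M" if "x \<in> space M" for x
    using that random_function_measurable_comp[OF ST(1) _ ident[OF sub_B]]
    by (auto simp: \<S>_def)
  have \<theta>_B: "\<theta> 1 \<in> B \<rightarrow>\<^sub>M Sf i" for i
    using measurable_from_subalg[OF sub_B measurable_shift_algebra[where \<theta>=\<theta> and t=1, OF \<theta>1 Sf]]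
    by (auto simp: \<S>_def)
  \<comment> \<open>Both random arguments are visible to \<open>B\<close>: the state
    \<open>T \<omega> x\<close> through \<open>ST\<close>, and the shifted noise
    \<open>\<theta> 1 \<omega>\<close> through the shifted copy of \<open>Sf i\<close>.\<close>
  have ft1_B: "(\<lambda>\<omega>. ft (\<theta> 1 \<omega>) (T \<omega> x) $ i) \<in> borel_measurable B" if "x \<in> space M" for x i
    using random_function_measurable_comp[OF ft(2) T_B[OF that] \<theta>_B] .

  \<comment> \<open>The two lags are those of the correlations in \<open>nr_dmd\<close>. Since
    \<open>\<theta> 0\<close> is the identity only on \<open>space P\<close>, the samples are
    simplified by congruence on that space.\<close>
  have lag_B: "(\<lambda>\<omega>. ft (\<theta> (int j) \<omega>) (cocycle T \<theta> j \<omega> x) $ i) \<in> borel_measurable B"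
    if "j \<in> {0, 1}" "x \<in> space M" for j x i
  proof (cases "j = 0")
    case True
    have "(\<lambda>\<omega>. ft (\<theta> (int j) \<omega>) (cocycle T \<theta> j \<omega> x) $ i) \<in> borel_measurable B \<longleftrightarrow>
        (\<lambda>\<omega>. ft \<omega> x $ i) \<in> borel_measurable B"
      by (rule measurable_cong) (simp add: True \<theta>0 spaces)
    with ft_B[OF that(2)] show ?thesis
      by simp
  next
    case False
    then have "(\<lambda>\<omega>. ft (\<theta> (int j) \<omega>) (cocycle T \<theta> j \<omega> x) $ i) \<in> borel_measurable B \<longleftrightarrow>
        (\<lambda>\<omega>. ft (\<theta> 1 \<omega>) (T \<omega> x) $ i) \<in> borel_measurable B"
      using that(1) by (intro measurable_cong) (auto simp: \<theta>0 spaces)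
    with ft1_B[OF that(2)] show ?thesis
      by simp
  qed
  \<comment> \<open>For fixed \<open>x\<close> the two factors are measurable for \<open>B\<close>
    and \<open>A\<close>, so their mean factors; \<open>koopman_mean\<close> supplies both the
    integrability and the value of the first mean.\<close>
  have inner: "AE x in \<mu>.
      (\<integral>\<omega>. outer (ft (\<theta> (int j) \<omega>) (cocycle T \<theta> j \<omega> x)) (gt \<omega> x) $ a $ b \<partial>P) =
        koopman P T \<theta> j (\<lambda>y. f y $ a) x * cnj (g x $ b)"
    if "j \<in> {0, 1}" for j a b
    using koopman_mean[of j a] g_mean(1)[of b] AE_space[of \<mu>]
  proof eventually_elim
    case (elim x)
    then have x: "x \<in> space M"
      by (simp add: space_\<mu>)
    have "(\<integral>\<omega>. ft (\<theta> (int j) \<omega>) (cocycle T \<theta> j \<omega> x) $ a * cnj (gt \<omega> x $ b) \<partial>P) =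
        (\<integral>\<omega>. ft (\<theta> (int j) \<omega>) (cocycle T \<theta> j \<omega> x) $ a \<partial>P) * cnj (\<integral>\<omega>. gt \<omega> x $ b \<partial>P)"
      using elim lag_B[OF that x] gt_A[OF x] indep
      by (intro P.indep_set_integral_mult_cnj[OF _ sub])
         (auto simp: A_def B_def \<S>_def has_bochner_integral_iff)
    then show ?case
      using elim(1) by (simp add: outer_def g_mean(2) noisy_mean_def has_bochner_integral_iff)
  qed

  \<comment> \<open>Limits of the empirical correlations\<close>
  define G where "G = (\<chi> a b. \<integral>x. f x $ a * cnj (g x $ b) \<partial>\<mu>)"
  define L where "L j =
      (\<chi> a b. \<integral>x. (\<integral>\<omega>. outer (ft (\<theta> (int j) \<omega>) (cocycle T \<theta> j \<omega> x)) (gt \<omega> x) $ a $ b \<partial>P) \<partial>\<mu>)"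
    for j
  \<comment> \<open>The factorization holds only almost everywhere, so replacing the integrand
    requires measurability in \<open>x\<close>, which follows from integrability on the product
    space.\<close>
  have inner_measurable: "(\<lambda>x. \<integral>\<omega>. outer (ft (\<theta> (int j) \<omega>) (cocycle T \<theta> j \<omega> x)) (gt \<omega> x) $ a $ b \<partial>P)
      \<in> borel_measurable \<mu>" for j a b
    using borel_measurable_integrable[OF correlations_integrable[of j a b]]
    by (rule P.borel_measurable_lebesgue_integral)
  have fg: "integrable \<mu> (\<lambda>x. f x $ a * cnj (g x $ b))" for a b
    using f_L2 g_L2 by (rule L2_integrable_mult_cnj)

  have "L 0 = G"
  proof -
    have "(\<integral>x. (\<integral>\<omega>. outer (ft (\<theta> (int 0) \<omega>) (cocycle T \<theta> 0 \<omega> x)) (gt \<omega> x) $ a $ b \<partial>P) \<partial>\<mu>) =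
        (\<integral>x. f x $ a * cnj (g x $ b) \<partial>\<mu>)" for a b
    proof (rule integral_cong_AE[OF inner_measurable])
      show "AE x in \<mu>. (\<integral>\<omega>. outer (ft (\<theta> (int 0) \<omega>) (cocycle T \<theta> 0 \<omega> x)) (gt \<omega> x) $ a $ b \<partial>P) =
          f x $ a * cnj (g x $ b)"
        \<comment> \<open>At time 0 the Koopman operator averages the constant
          \<open>f x $ a\<close> over a probability space and returns it.\<close>
        using inner[of 0 a b] by (simp add: koopman_def P.prob_space)
    qed (use fg in auto)
    then show ?thesis
      by (simp only: L_def G_def)
  qed
  have "L 1 = K ** G"
  proof -
    have "(\<integral>x. (\<integral>\<omega>. outer (ft (\<theta> (int 1) \<omega>) (cocycle T \<theta> 1 \<omega> x)) (gt \<omega> x) $ a $ b \<partial>P) \<partial>\<mu>) =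
        (\<integral>x. (\<Sum>c\<in>UNIV. K $ a $ c * (f x $ c * cnj (g x $ b))) \<partial>\<mu>)" for a b
    proof (rule integral_cong_AE[OF inner_measurable])
      show "AE x in \<mu>. (\<integral>\<omega>. outer (ft (\<theta> (int 1) \<omega>) (cocycle T \<theta> 1 \<omega> x)) (gt \<omega> x) $ a $ b \<partial>P) =
          (\<Sum>c\<in>UNIV. K $ a $ c * (f x $ c * cnj (g x $ b)))"
        \<comment> \<open>The matrix relation \<open>K\<close> expands the Koopman image of
          component \<open>a\<close> along row \<open>a\<close>; by linearity the constant row moves
          out of the integral, leaving \<open>K ** G\<close>.\<close>
        using inner[of 1 a b, simplified] K
      proof eventually_elim
        case (elim x)
        then have "koopman P T \<theta> 1 (\<lambda>y. f y $ a) x = (K *v f x) $ a"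
          by (metis vec_lambda_beta)
        then show ?case
          using elim(1) by (simp add: matrix_vector_mult_def sum_distrib_right mult.assoc)
      qed
    qed (use fg in auto)
    also have "(\<integral>x. (\<Sum>c\<in>UNIV. K $ a $ c * (f x $ c * cnj (g x $ b))) \<partial>\<mu>) = (K ** G) $ a $ b" for a b
      using fg by (simp add: matrix_matrix_mult_def G_def)
    finally show ?thesis
      by (simp only: L_def vec_eq_iff vec_lambda_beta) simp
  qed

  \<comment> \<open>Full row rank of the limit and convergence of the estimator\<close>
  have f_indep: "L2_independent \<mu> UNIV (\<lambda>i x. f x $ i)"
    using f_L2 F_dim unfolding F by (rule L2_independent_if_dim)
  have full_rank: "w = 0" if "ctranspose G *v w = 0" for w
    by (rule L2_gram_full_rank[of "\<lambda>i x. f x $ i" \<mu> "\<lambda>j x. g x $ j", OF f_L2 g_L2 f_indep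
          F_span[unfolded F] that[unfolded G_def]])
  have "AE z in \<mu> \<Otimes>\<^sub>M P. case z of (x, \<omega>) \<Rightarrow> (\<lambda>n. empirical_correlation T \<theta> ft gt 0 n x \<omega>) \<longlonglongrightarrow> G"
    using correlations_converge[of 0] unfolding L_def[symmetric] \<open>L 0 = G\<close> .
  moreover
  have "AE z in \<mu> \<Otimes>\<^sub>M P. case z of (x, \<omega>) \<Rightarrow> (\<lambda>n. empirical_correlation T \<theta> ft gt 1 n x \<omega>) \<longlonglongrightarrow> K ** G"
    using correlations_converge[of 1] unfolding L_def[symmetric] \<open>L 1 = K ** G\<close> .
  \<comment> \<open>On the intersection of the two almost sure events, convergence is a
    deterministic statement about matrices.\<close>
  ultimately show ?thesis
  proof eventually_elim
    case (elim z)
    obtain x \<omega> where z: "z = (x, \<omega>)"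
      by fastforce
    show ?case
      using elim unfolding z case_prod_conv nr_dmd_def by (intro tendsto_mult_pinv full_rank)
  qed
qed

end
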